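(* Let $p\in\mathbb{R}[X_1,\ldots,X_n]$ be a symmetric and homogeneous quadratic form. If $p$ is non-negative (on $\mathbb{R}^n$), then $p$ can be written in the form $$p=\alpha(X_1+\cdots+X_n)^2+\beta\sum_{i<j}(X_j-X_i)^2=(\alpha+(n-1)\beta)\sum_i X_i^2+2(\alpha-\beta)\sum_{i<j}X_iX_j$$ with some coefficients $\alpha,\beta\ge 0$.
   Context: Symmetric means invariant under all permutations of the variables $X_1,\ldots,X_n$. *)

theory Defs
  imports Complex_Main "HOL-Library.Poly_Mapping" "HOL-Library.FuncSet" "HOL-Combinatorics.Permutations"
begin

text \<open>
  Polynomials are finitely supported families of coefficients indexed by monomials, a monomial
  being a finitely supported family of exponents. The ring structure is the convolution product
  of \<^theory>\<open>HOL-Library.Poly_Mapping\<close>. The variables are \<open>X\<^sub>i\<close> for all naturals \<open>i\<close>; the ring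
  \<open>R[X\<^sub>1, \<dots>, X\<^sub>n]\<close> is the subring \<open>polys_in n\<close>.
\<close>

type_synonym 'a mpoly = "(nat \<Rightarrow>\<^sub>0 nat) \<Rightarrow>\<^sub>0 'a"

definition Const :: "'a::zero \<Rightarrow> 'a mpoly"
  where "Const c = Poly_Mapping.single 0 c"

definition X :: "nat \<Rightarrow> 'a::zero_neq_one mpoly"
  where "X i = Poly_Mapping.single (Poly_Mapping.single i 1) 1"

definition polys_in :: "nat \<Rightarrow> 'a::zero mpoly set"
  where "polys_in n = {p. \<forall>m \<in> Poly_Mapping.keys p. Poly_Mapping.keys m \<subseteq> {1..n}}"

definition evaluate :: "(nat \<Rightarrow> 'a) \<Rightarrow> 'a::comm_semiring_1 mpoly \<Rightarrow> 'a"
  where "evaluate x p =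
    (\<Sum>m\<in>Poly_Mapping.keys p. Poly_Mapping.lookup p m * (\<Prod>i\<in>Poly_Mapping.keys m. x i ^ Poly_Mapping.lookup m i))"

definition substitute :: "(nat \<Rightarrow> 'a mpoly) \<Rightarrow> 'a::comm_semiring_1 mpoly \<Rightarrow> 'a mpoly"
  where "substitute q p =
    (\<Sum>m\<in>Poly_Mapping.keys p. Const (Poly_Mapping.lookup p m) * (\<Prod>i\<in>Poly_Mapping.keys m. q i ^ Poly_Mapping.lookup m i))"

definition symmetric :: "nat \<Rightarrow> 'a::comm_semiring_1 mpoly \<Rightarrow> bool"
  where "symmetric n p \<longleftrightarrow> (\<forall>\<sigma>. \<sigma> permutes {1..n} \<longrightarrow> substitute (\<lambda>i. X (\<sigma> i)) p = p)"

text \<open>The zero polynomial is homogeneous of every degree; in particular it is a quadratic form.\<close>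

definition homogeneous :: "nat \<Rightarrow> 'a::zero mpoly \<Rightarrow> bool"
  where "homogeneous d p \<longleftrightarrow> (\<forall>m \<in> Poly_Mapping.keys p. (\<Sum>i\<in>Poly_Mapping.keys m. Poly_Mapping.lookup m i) = d)"

text \<open>Points of \<open>\<real>\<^sup>n\<close> are the functions on \<open>{1..n}\<close>, extended by \<^const>\<open>undefined\<close>.\<close>

definition nonneg_poly :: "nat \<Rightarrow> real mpoly \<Rightarrow> bool"
  where "nonneg_poly n p \<longleftrightarrow> (\<forall>x \<in> {1..n} \<rightarrow>\<^sub>E UNIV. 0 \<le> evaluate x p)"

end

theory Submission
  imports Defs
begin

text \<open>
  By symmetry the form is \<open>a \<Sum> X\<^sub>i\<^sup>2 + b \<Sum>\<^bsub>i<j\<^esub> X\<^sub>i X\<^sub>j\<close>, which determines \<open>\<alpha>\<close> and \<open>\<beta>\<close>: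
  \<open>n \<beta> = a - b / 2\<close> and \<open>\<alpha> = \<beta> + b / 2\<close>. Evaluation at \<open>(1, \<dots>, 1)\<close> gives \<open>n\<^sup>2 \<alpha> \<ge> 0\<close>, and evaluation
  at \<open>(1, -1, 0, \<dots>, 0)\<close> kills the first square and gives \<open>\<beta> \<ge> 0\<close>.
\<close>

section \<open>Quadratic identities over a commutative ring\<close>

definition lt_pairs :: "nat \<Rightarrow> (nat \<times> nat) set"
  where "lt_pairs n = {(i, j). i \<in> {1..n} \<and> j \<in> {1..n} \<and> i < j}"

lemma finite_lt_pairs: "finite (lt_pairs n)"
  by (rule finite_subset[of _ "{1..n} \<times> {1..n}"]) (auto simp: lt_pairs_def)

text \<open>The only new pairs are those whose larger index is \<open>Suc n\<close>. This recursion
  drives the inductions for the identities below.\<close>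

lemma sum_lt_pairs_Suc:
  "(\<Sum>(i, j)\<in>lt_pairs (Suc n). f i j) = (\<Sum>(i, j)\<in>lt_pairs n. f i j) + (\<Sum>i\<in>{1..n}. f i (Suc n))"
proof -
  have eq: "lt_pairs (Suc n) = lt_pairs n \<union> (\<lambda>i. (i, Suc n)) ` {1..n}"
    by (auto simp: lt_pairs_def)
  have disj: "lt_pairs n \<inter> (\<lambda>i. (i, Suc n)) ` {1..n} = {}"
    by (auto simp: lt_pairs_def)
  have inj: "inj_on (\<lambda>i. (i, Suc n)) {1..n}"
    by (auto simp: inj_on_def)
  show ?thesis
    unfolding eq
    by (subst sum.union_disjoint[OF finite_lt_pairs _ disj]) (simp_all only: sum.reindex[OF inj] o_def prod.case finite_imageI finite_atLeastAtMost)
qed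

lemma square_of_sum_lt_pairs:
  fixes x :: "nat \<Rightarrow> 'a::comm_ring_1"
  shows "(\<Sum>i\<in>{1..n}. x i)\<^sup>2 = (\<Sum>i\<in>{1..n}. (x i)\<^sup>2) + 2 * (\<Sum>(i, j)\<in>lt_pairs n. x i * x j)"
proof (induction n)
  case 0
  then show ?case by (simp add: lt_pairs_def)
next
  case (Suc n)
  have "(\<Sum>i\<in>{1..n}. x i * x (Suc n)) = (\<Sum>i\<in>{1..n}. x i) * x (Suc n)"
    by (simp add: sum_distrib_right)
  with Suc show ?case
    by (simp only: sum_lt_pairs_Suc) (simp add: power2_sum algebra_simps)
qed

text \<open>Lagrange's identity for x and the all-ones vector: the differences contribute each
  square n - 1 times, and the square of the sum supplies one more copy while cancelling the mixed
  products.\<close>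

lemma sum_squared_differences_lt_pairs:
  fixes x :: "nat \<Rightarrow> 'a::comm_ring_1"
  shows "(\<Sum>(i, j)\<in>lt_pairs n. (x j - x i)\<^sup>2) + (\<Sum>i\<in>{1..n}. x i)\<^sup>2 = of_nat n * (\<Sum>i\<in>{1..n}. (x i)\<^sup>2)"
proof (induction n)
  case 0
  then show ?case by (simp add: lt_pairs_def)
next
  case (Suc n)
  have "(\<Sum>i\<in>{1..n}. (x (Suc n) - x i)\<^sup>2) =
      of_nat n * (x (Suc n))\<^sup>2 + (\<Sum>i\<in>{1..n}. (x i)\<^sup>2) - 2 * x (Suc n) * (\<Sum>i\<in>{1..n}. x i)"
    by (simp add: power2_diff sum.distrib sum_subtractf sum_distrib_left)
  with Suc show ?case
    by (simp only: sum_lt_pairs_Suc) (simp add: power2_sum algebra_simps)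
qed

text \<open>Stated over an arbitrary commutative ring because it is used twice: for real values of
  the variables and for the variables themselves in the polynomial ring.\<close>

lemma quadratic_form_rewrite:
  fixes x :: "nat \<Rightarrow> 'a::comm_ring_1"
  shows "u * (\<Sum>i\<in>{1..n}. x i)\<^sup>2 + v * (\<Sum>(i, j)\<in>lt_pairs n. (x j - x i)\<^sup>2) =
    (u + (of_nat n - 1) * v) * (\<Sum>i\<in>{1..n}. (x i)\<^sup>2) + 2 * (u - v) * (\<Sum>(i, j)\<in>lt_pairs n. x i * x j)"
proof -
  have T: "(\<Sum>(i, j)\<in>lt_pairs n. (x j - x i)\<^sup>2) =
      of_nat n * (\<Sum>i\<in>{1..n}. (x i)\<^sup>2) - (\<Sum>i\<in>{1..n}. x i)\<^sup>2"
    using sum_squared_differences_lt_pairs[of x n] by (simp add: eq_diff_eq)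
  show ?thesis
    unfolding T square_of_sum_lt_pairs by (simp add: algebra_simps)
qed

section \<open>Action of renaming variables on coefficients\<close>

lemma X_power: "X i ^ k = (Poly_Mapping.single (Poly_Mapping.single i k) 1 :: 'a::comm_semiring_1 mpoly)"
  by (induction k) (simp_all add: X_def mult_single single_add[symmetric])

lemma prod_single:
  "(\<Prod>i\<in>A. Poly_Mapping.single (f i) (1::'a::comm_semiring_1)) =
    Poly_Mapping.single (\<Sum>i\<in>A. (f i :: nat \<Rightarrow>\<^sub>0 nat)) 1"
  by (induction A rule: infinite_finite_induct) (simp_all add: mult_single)

lemma Const_mult_single: "Const c * Poly_Mapping.single m d = Poly_Mapping.single m (c * d)"
  for c :: "'a::semiring_0"
  by (simp add: Const_def mult_single)

text \<open>The exponent of the renamed monomial at k comes from the unique index that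
  \<open>\<sigma>\<close> sends to k. Pushing exponents forward along \<open>\<sigma>\<close> is
  therefore precomposition with its inverse.\<close>

lemma sum_renamed_monomial:
  assumes "bij \<sigma>"
  shows "(\<Sum>i\<in>Poly_Mapping.keys m. Poly_Mapping.single (\<sigma> i) (Poly_Mapping.lookup m i)) =
    Poly_Mapping.map_key (inv \<sigma>) (m :: nat \<Rightarrow>\<^sub>0 nat)"
proof (rule poly_mapping_eqI)
  fix k
  have "(\<Sum>i\<in>Poly_Mapping.keys m. Poly_Mapping.lookup m i when \<sigma> i = k) =
      (\<Sum>i\<in>Poly_Mapping.keys m. if i = inv \<sigma> k then Poly_Mapping.lookup m i else 0)"
    using assms by (intro sum.cong) (auto simp: when_def bij_inv_eq_iff)
  also have "\<dots> = Poly_Mapping.lookup m (inv \<sigma> k)"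
    by (simp add: sum.delta in_keys_iff)
  finally show "Poly_Mapping.lookup (\<Sum>i\<in>Poly_Mapping.keys m.
      Poly_Mapping.single (\<sigma> i) (Poly_Mapping.lookup m i)) k =
    Poly_Mapping.lookup (Poly_Mapping.map_key (inv \<sigma>) m) k"
    using assms by (simp add: lookup_sum lookup_single map_key.rep_eq bij_imp_bij_inv bij_is_inj)
qed

text \<open>A bijective renaming permutes the monomials, so no two terms of p merge and at most one
  of them contributes to the coefficient of m.\<close>

lemma lookup_substitute_rename:
  fixes p :: "'a::comm_semiring_1 mpoly"
  assumes "bij \<sigma>"
  shows "Poly_Mapping.lookup (substitute (\<lambda>i. X (\<sigma> i)) p) m =
    Poly_Mapping.lookup p (Poly_Mapping.map_key \<sigma> m)"
proof -
  have inj: "inj \<sigma>" "inj (inv \<sigma>)"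
    using assms by (auto simp: bij_is_inj bij_imp_bij_inv)
  have iff: "Poly_Mapping.map_key (inv \<sigma>) m' = m \<longleftrightarrow> m' = Poly_Mapping.map_key \<sigma> m" for m'
    using assms inj
    by (auto simp: poly_mapping_eq_iff map_key.rep_eq fun_eq_iff bij_is_surj surj_f_inv_f)
       (metis inv_f_f)
  have "substitute (\<lambda>i. X (\<sigma> i)) p = (\<Sum>m'\<in>Poly_Mapping.keys p.
      Poly_Mapping.single (Poly_Mapping.map_key (inv \<sigma>) m') (Poly_Mapping.lookup p m'))"
    by (simp add: substitute_def X_power prod_single Const_mult_single sum_renamed_monomial[OF assms])
  then have "Poly_Mapping.lookup (substitute (\<lambda>i. X (\<sigma> i)) p) m =
      (\<Sum>m'\<in>Poly_Mapping.keys p.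
        if m' = Poly_Mapping.map_key \<sigma> m then Poly_Mapping.lookup p m' else 0)"
    by (simp add: lookup_sum lookup_single iff when_def)
  also have "\<dots> = Poly_Mapping.lookup p (Poly_Mapping.map_key \<sigma> m)"
    by (simp add: sum.delta in_keys_iff)
  finally show ?thesis .
qed

section \<open>Coefficients of a symmetric polynomial\<close>

abbreviation sq_mon :: "nat \<Rightarrow> (nat \<Rightarrow>\<^sub>0 nat)"
  where "sq_mon i \<equiv> Poly_Mapping.single i 2"

abbreviation pair_mon :: "nat \<Rightarrow> nat \<Rightarrow> (nat \<Rightarrow>\<^sub>0 nat)"
  where "pair_mon i j \<equiv> Poly_Mapping.single i 1 + Poly_Mapping.single j 1"

lemma symmetric_lookup_single:
  assumes "symmetric n p" "\<sigma> permutes {1..n}"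
  shows "Poly_Mapping.lookup p (Poly_Mapping.single (\<sigma> i) k) = Poly_Mapping.lookup p (Poly_Mapping.single i k)"
proof -
  have "bij \<sigma>" using assms(2) by (rule permutes_bij)
  moreover have "Poly_Mapping.map_key \<sigma> (Poly_Mapping.single (\<sigma> i) k) = Poly_Mapping.single i k"
    by (simp add: map_key_single \<open>bij \<sigma>\<close> bij_is_inj)
  ultimately show ?thesis
    using assms lookup_substitute_rename[of \<sigma> p "Poly_Mapping.single (\<sigma> i) k"]
    by (simp add: symmetric_def)
qed

lemma symmetric_lookup_pair_mon:
  assumes "symmetric n p" "\<sigma> permutes {1..n}"
  shows "Poly_Mapping.lookup p (pair_mon (\<sigma> i) (\<sigma> j)) = Poly_Mapping.lookup p (pair_mon i j)"
proof -
  have "bij \<sigma>" using assms(2) by (rule permutes_bij)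
  moreover have "Poly_Mapping.map_key \<sigma> (pair_mon (\<sigma> i) (\<sigma> j)) = pair_mon i j"
    by (simp add: map_key_plus map_key_single \<open>bij \<sigma>\<close> bij_is_inj)
  ultimately show ?thesis
    using assms lookup_substitute_rename[of \<sigma> p "pair_mon (\<sigma> i) (\<sigma> j)"]
    by (simp add: symmetric_def)
qed

lemma symmetric_lookup_sq_mon_eq:
  assumes "symmetric n p" "i \<in> {1..n}"
  shows "Poly_Mapping.lookup p (sq_mon i) = Poly_Mapping.lookup p (sq_mon 1)"
proof -
  have "transpose 1 i permutes {1..n}"
    using assms(2) by (intro permutes_swap_id) auto
  from symmetric_lookup_single[OF assms(1) this, of 1 2] show ?thesis by simp
qed

text \<open>Permutations act transitively on ordered pairs of distinct indices: a product of two
  transpositions carries (1, 2) to (i, j).\<close>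

lemma symmetric_lookup_pair_mon_eq:
  assumes "symmetric n p" "(i, j) \<in> lt_pairs n"
  shows "Poly_Mapping.lookup p (pair_mon i j) = Poly_Mapping.lookup p (pair_mon 1 2)"
proof -
  have ij: "i \<in> {1..n}" "j \<in> {1..n}" "i < j"
    using assms(2) by (auto simp: lt_pairs_def)
  \<comment> \<open>The first transposition sends 1 to i and 2 to c. The second then moves c to j
    and fixes i, since i differs from both c and j.\<close>
  define c where "c = transpose 1 i 2"
  have t: "transpose 1 i permutes {1..n}"
    using ij by (intro permutes_swap_id) auto
  have "2 \<in> {1..n}" using ij by auto
  then have c: "c \<in> {1..n}"
    unfolding c_def using permutes_in_image[OF t] by blast
  have "c \<noteq> i"
    unfolding c_def by (auto simp: transpose_def)
  have "transpose c j permutes {1..n}"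
    using c ij by (intro permutes_swap_id) auto
  with t have s: "transpose c j \<circ> transpose 1 i permutes {1..n}"
    by (rule permutes_compose)
  have 1: "(transpose c j \<circ> transpose 1 i) 1 = i"
    using \<open>c \<noteq> i\<close> ij by (simp add: transpose_def)
  have 2: "(transpose c j \<circ> transpose 1 i) 2 = j"
    by (simp add: c_def)
  show ?thesis
    using symmetric_lookup_pair_mon[OF assms(1) s, of 1 2] unfolding 1 2 .
qed

section \<open>Monomials of degree two\<close>

definition quad_mons :: "nat \<Rightarrow> (nat \<Rightarrow>\<^sub>0 nat) set"
  where "quad_mons n = sq_mon ` {1..n} \<union> (\<lambda>(i, j). pair_mon i j) ` lt_pairs n"

lemma finite_quad_mons: "finite (quad_mons n)"
  by (simp add: quad_mons_def finite_lt_pairs)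

lemma keys_pair_mon: "Poly_Mapping.keys (pair_mon i j) = {i, j}"
  by (auto simp: in_keys_iff lookup_add lookup_single when_def split: if_splits)

text \<open>The number of variables in a monomial separates the two families, and the condition i <
  j makes a mixed monomial determine its pair.\<close>

lemma sum_quad_mons:
  "(\<Sum>m\<in>quad_mons n. f m) = (\<Sum>i\<in>{1..n}. f (sq_mon i)) + (\<Sum>(i, j)\<in>lt_pairs n. f (pair_mon i j))"
proof -
  have "inj_on sq_mon {1..n}"
    by (auto simp: inj_on_def poly_mapping_eq_iff fun_eq_iff lookup_single when_def split: if_splits)
  moreover have "inj_on (\<lambda>(i, j). pair_mon i j) (lt_pairs n)"
  proof (rule inj_onI, clarsimp)
    fix i j i' j'
    assume *: "(i, j) \<in> lt_pairs n" "(i', j') \<in> lt_pairs n"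
      and "Poly_Mapping.single i (Suc 0) + Poly_Mapping.single j (Suc 0) =
        Poly_Mapping.single i' (Suc 0) + Poly_Mapping.single j' (Suc 0)"
    then have "{i, j} = {i', j'}"
      using keys_pair_mon[of i j] keys_pair_mon[of i' j'] by simp
    with * show "i = i' \<and> j = j'"
      by (auto simp: lt_pairs_def doubleton_eq_iff)
  qed
  moreover have "sq_mon ` {1..n} \<inter> (\<lambda>(i, j). pair_mon i j) ` lt_pairs n = {}"
  proof -
    have "sq_mon k \<noteq> pair_mon i j" if "i < j" for i j k
    proof
      assume "sq_mon k = pair_mon i j"
      from arg_cong[OF this, of Poly_Mapping.keys] have "{k} = {i, j}"
        unfolding keys_pair_mon by simp
      with that show False by auto
    qed
    then show ?thesis by (fastforce simp: lt_pairs_def)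
  qed
  ultimately show ?thesis
    unfolding quad_mons_def
    by (subst sum.union_disjoint)
       (simp_all add: finite_lt_pairs sum.reindex case_prod_unfold)
qed

text \<open>Exponents at keys are positive integers with sum 2, so there is either one key with
  exponent 2 or two keys with exponent 1.\<close>

lemma degree_2_monomial_cases:
  assumes "Poly_Mapping.keys m \<subseteq> {1..n}"
    and "(\<Sum>i\<in>Poly_Mapping.keys m. Poly_Mapping.lookup m i) = 2"
  shows "m \<in> quad_mons n"
proof -
  have pos: "0 < Poly_Mapping.lookup m i" if "i \<in> Poly_Mapping.keys m" for i
    using that by (simp add: in_keys_iff)
  have "Poly_Mapping.keys m \<noteq> {}"
    using assms(2) by auto
  then obtain i where i: "i \<in> Poly_Mapping.keys m" by blast
  have sum_i: "Poly_Mapping.lookup m i + (\<Sum>k\<in>Poly_Mapping.keys m - {i}. Poly_Mapping.lookup m k) = 2"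
    using assms(2) sum.remove[OF finite_keys i, of "Poly_Mapping.lookup m"] by simp
  show ?thesis
  proof (cases "Poly_Mapping.keys m = {i}")
    case True
    then have "Poly_Mapping.lookup m i = 2" using assms(2) by simp
    with True have "m = sq_mon i"
      by (intro poly_mapping_eqI) (metis in_keys_iff lookup_single_eq lookup_single_not_eq singletonD)
    with i assms(1) show ?thesis by (auto simp: quad_mons_def)
  next
    case False
    then obtain j where j: "j \<in> Poly_Mapping.keys m - {i}" using i by blast
    have sum_ij: "Poly_Mapping.lookup m i + (Poly_Mapping.lookup m j
        + (\<Sum>k\<in>Poly_Mapping.keys m - {i} - {j}. Poly_Mapping.lookup m k)) = 2"
      using sum_i sum.remove[OF _ j, of "Poly_Mapping.lookup m"] by simp
    have "0 < Poly_Mapping.lookup m i" "0 < Poly_Mapping.lookup m j"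
      using pos i j by auto
    with sum_ij have ones: "Poly_Mapping.lookup m i = 1" "Poly_Mapping.lookup m j = 1"
      and rest: "(\<Sum>k\<in>Poly_Mapping.keys m - {i} - {j}. Poly_Mapping.lookup m k) = 0"
      by linarith+
    have "Poly_Mapping.lookup m k = 0" if "k \<noteq> i" "k \<noteq> j" for k
      using rest that by (auto simp: in_keys_iff)
    with ones j have "m = pair_mon i j"
      by (intro poly_mapping_eqI) (auto simp: lookup_add lookup_single when_def)
    \<comment> \<open>The order of i and j is unknown, so both readings of the monomial are kept
      until the pair in \<open>lt_pairs n\<close> is chosen.\<close>
    moreover from this have "m = pair_mon j i" by (simp add: add.commute)
    moreover have "(i, j) \<in> lt_pairs n \<or> (j, i) \<in> lt_pairs n"
      using i j assms(1) by (auto simp: lt_pairs_def)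
    ultimately show ?thesis
      unfolding quad_mons_def by (metis (mono_tags, lifting) UnI2 case_prod_conv image_eqI)
  qed
qed

lemma quadratic_form_keys:
  assumes "p \<in> polys_in n" "homogeneous 2 p"
  shows "Poly_Mapping.keys p \<subseteq> quad_mons n"
  using assms degree_2_monomial_cases by (auto simp: polys_in_def homogeneous_def)

section \<open>Normal form of a symmetric quadratic form\<close>

lemma sum_single_lookup:
  assumes "finite A" "Poly_Mapping.keys p \<subseteq> A"
  shows "p = (\<Sum>m\<in>A. Poly_Mapping.single m (Poly_Mapping.lookup p m))"
proof (rule poly_mapping_eqI)
  fix k
  have "Poly_Mapping.lookup (\<Sum>m\<in>A. Poly_Mapping.single m (Poly_Mapping.lookup p m)) k =
      (\<Sum>m\<in>A. if m = k then Poly_Mapping.lookup p m else 0)"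
    by (simp add: lookup_sum lookup_single when_def)
  also have "\<dots> = Poly_Mapping.lookup p k"
    using assms by (auto simp: sum.delta in_keys_iff)
  finally show "Poly_Mapping.lookup p k =
    Poly_Mapping.lookup (\<Sum>m\<in>A. Poly_Mapping.single m (Poly_Mapping.lookup p m)) k" ..
qed

text \<open>Symmetry makes the coefficient constant on squares and on mixed products, with the
  indices 1 and (1, 2) as representatives. If n is too small for a representative to exist, the
  corresponding sum is empty.\<close>

lemma symmetric_quadratic_form_eq:
  fixes p :: "'a::comm_semiring_1 mpoly"
  assumes "p \<in> polys_in n" "symmetric n p" "homogeneous 2 p"
  shows "p = Const (Poly_Mapping.lookup p (sq_mon 1)) * (\<Sum>i\<in>{1..n}. (X i)\<^sup>2)
    + Const (Poly_Mapping.lookup p (pair_mon 1 2)) * (\<Sum>(i, j)\<in>lt_pairs n. X i * X j)"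
    (is "p = Const ?a * _ + Const ?b * _")
proof -
  have "p = (\<Sum>i\<in>{1..n}. Poly_Mapping.single (sq_mon i) (Poly_Mapping.lookup p (sq_mon i)))
      + (\<Sum>(i, j)\<in>lt_pairs n. Poly_Mapping.single (pair_mon i j) (Poly_Mapping.lookup p (pair_mon i j)))"
    using sum_single_lookup[OF finite_quad_mons quadratic_form_keys[OF assms(1,3)]]
    by (simp only: sum_quad_mons)
  also have "(\<Sum>i\<in>{1..n}. Poly_Mapping.single (sq_mon i) (Poly_Mapping.lookup p (sq_mon i))) =
      (\<Sum>i\<in>{1..n}. Const ?a * (X i)\<^sup>2)"
  proof (intro sum.cong refl)
    fix i assume i: "i \<in> {1..n}"
    show "Poly_Mapping.single (sq_mon i) (Poly_Mapping.lookup p (sq_mon i)) = Const ?a * (X i)\<^sup>2"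
      unfolding symmetric_lookup_sq_mon_eq[OF assms(2) i] by (simp add: X_power Const_mult_single)
  qed
  also have "(\<Sum>(i, j)\<in>lt_pairs n. Poly_Mapping.single (pair_mon i j) (Poly_Mapping.lookup p (pair_mon i j))) =
      (\<Sum>(i, j)\<in>lt_pairs n. Const ?b * (X i * X j))"
  proof (intro sum.cong refl, clarify)
    fix i j assume ij: "(i, j) \<in> lt_pairs n"
    show "Poly_Mapping.single (pair_mon i j) (Poly_Mapping.lookup p (pair_mon i j)) = Const ?b * (X i * X j)"
      unfolding symmetric_lookup_pair_mon_eq[OF assms(2) ij]
      by (simp add: X_def mult_single Const_mult_single)
  qed
  finally show ?thesis
    by (simp add: sum_distrib_left case_prod_unfold)
qed

text \<open>Follows from the definition of \<open>evaluate\<close>: the sum over the keys extends to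
  \<open>quad_mons n\<close>, because the added monomials have coefficient zero.\<close>

lemma evaluate_symmetric_quadratic_form:
  fixes p :: "'a::comm_semiring_1 mpoly"
  assumes "p \<in> polys_in n" "symmetric n p" "homogeneous 2 p"
  shows "evaluate x p = Poly_Mapping.lookup p (sq_mon 1) * (\<Sum>i\<in>{1..n}. (x i)\<^sup>2)
    + Poly_Mapping.lookup p (pair_mon 1 2) * (\<Sum>(i, j)\<in>lt_pairs n. x i * x j)"
    (is "_ = ?a * _ + ?b * _")
proof -
  define v where "v m = Poly_Mapping.lookup p m * (\<Prod>i\<in>Poly_Mapping.keys m. x i ^ Poly_Mapping.lookup m i)"
    for m
  have "evaluate x p = (\<Sum>m\<in>quad_mons n. v m)"
    unfolding evaluate_def v_def
    by (intro sum.mono_neutral_left finite_quad_mons quadratic_form_keys assms) (simp add: in_keys_iff)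
  also have "\<dots> = (\<Sum>i\<in>{1..n}. v (sq_mon i)) + (\<Sum>(i, j)\<in>lt_pairs n. v (pair_mon i j))"
    by (rule sum_quad_mons)
  also have "(\<Sum>i\<in>{1..n}. v (sq_mon i)) = (\<Sum>i\<in>{1..n}. ?a * (x i)\<^sup>2)"
  proof (intro sum.cong refl)
    fix i assume i: "i \<in> {1..n}"
    show "v (sq_mon i) = ?a * (x i)\<^sup>2"
      unfolding v_def symmetric_lookup_sq_mon_eq[OF assms(2) i] by simp
  qed
  also have "(\<Sum>(i, j)\<in>lt_pairs n. v (pair_mon i j)) = (\<Sum>(i, j)\<in>lt_pairs n. ?b * (x i * x j))"
  proof (intro sum.cong refl, clarify)
    fix i j assume ij: "(i, j) \<in> lt_pairs n"
    \<comment> \<open>Distinctness makes the product over the keys \<open>{i, j}\<close> have two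
      factors, each with exponent 1.\<close>
    then have "i \<noteq> j" by (auto simp: lt_pairs_def)
    then show "v (pair_mon i j) = ?b * (x i * x j)"
      unfolding v_def keys_pair_mon symmetric_lookup_pair_mon_eq[OF assms(2) ij]
      by (simp add: lookup_add lookup_single)
  qed
  finally show ?thesis
    by (simp add: sum_distrib_left case_prod_unfold)
qed

section \<open>Signs of the two coefficients\<close>

lemma nonneg_polyD: "nonneg_poly n p \<Longrightarrow> 0 \<le> evaluate (restrict x {1..n}) p"
  by (auto simp: nonneg_poly_def)

theorem corollary4p12:
  fixes n :: nat and p :: "real mpoly"
  assumes "p \<in> polys_in n"
    and "symmetric n p"
    and "homogeneous 2 p"
    and "nonneg_poly n p"
  shows "\<exists>\<alpha> \<beta> :: real. \<alpha> \<ge> 0 \<and> \<beta> \<ge> 0 \<and>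
    p = Const \<alpha> * (\<Sum>i\<in>{1..n}. X i)\<^sup>2
        + Const \<beta> * (\<Sum>(i, j)\<in>{(i, j). i \<in> {1..n} \<and> j \<in> {1..n} \<and> i < j}. (X j - X i)\<^sup>2) \<and>
    p = Const (\<alpha> + (real n - 1) * \<beta>) * (\<Sum>i\<in>{1..n}. (X i)\<^sup>2)
        + Const (2 * (\<alpha> - \<beta>)) * (\<Sum>(i, j)\<in>{(i, j). i \<in> {1..n} \<and> j \<in> {1..n} \<and> i < j}. X i * X j)"
proof (cases "n = 0")
  \<comment> \<open>The formula for \<beta> divides by n. Here p is zero and both coefficients are
    chosen as 0.\<close>
  case True
  have "p = 0"
    using symmetric_quadratic_form_eq[OF assms(1-3)] True by (simp add: lt_pairs_def)
  with True show ?thesis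
    by (intro exI[of _ 0]) simp
next
  case False
  define a where "a = Poly_Mapping.lookup p (sq_mon 1)"
  define b where "b = Poly_Mapping.lookup p (pair_mon 1 2)"
  define \<beta> where "\<beta> = (a - b / 2) / n"
  define \<alpha> where "\<alpha> = \<beta> + b / 2"
  have a: "\<alpha> + (real n - 1) * \<beta> = a" and b: "2 * (\<alpha> - \<beta>) = b"
    using False by (simp_all add: \<alpha>_def \<beta>_def field_simps)
  have val: "evaluate x p =
      \<alpha> * (\<Sum>i\<in>{1..n}. x i)\<^sup>2 + \<beta> * (\<Sum>(i, j)\<in>lt_pairs n. (x j - x i)\<^sup>2)" for x
    unfolding quadratic_form_rewrite a b
    using evaluate_symmetric_quadratic_form[OF assms(1-3)] by (simp add: a_def b_def)
  have "0 \<le> \<alpha> * (real n)\<^sup>2 + \<beta> * (\<Sum>(i, j)\<in>lt_pairs n. 0)"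
  proof -
    \<comment> \<open>Both indices of a pair lie in \<open>{1..n}\<close>, so the value
      \<open>undefined\<close> outside that range never enters and all differences vanish.\<close>
    have "(\<Sum>(i, j)\<in>lt_pairs n. (restrict (\<lambda>_. 1) {1..n} j - restrict (\<lambda>_. 1) {1..n} i)\<^sup>2) =
        (\<Sum>(i, j)\<in>lt_pairs n. 0::real)"
      by (intro sum.cong) (auto simp: lt_pairs_def)
    then show ?thesis
      using nonneg_polyD[OF assms(4), of "\<lambda>_. 1"] unfolding val by simp
  qed
  then have \<alpha>: "0 \<le> \<alpha>"
    using False by (simp add: case_prod_unfold zero_le_mult_iff)
  have \<beta>: "0 \<le> \<beta>"
  proof (cases "n = 1")
    case True
    \<comment> \<open>The point with coordinates 1 and -1 needs two variables. With one variable the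
      mixed coefficient b is zero, hence \<beta> = \<alpha>.\<close>
    have "pair_mon 1 2 \<notin> Poly_Mapping.keys p"
    proof
      assume "pair_mon 1 2 \<in> Poly_Mapping.keys p"
      with assms(1) True have "Poly_Mapping.keys (pair_mon 1 2) \<subseteq> {1..1}"
        unfolding polys_in_def by blast
      then show False unfolding keys_pair_mon by simp
    qed
    then have "b = 0" by (simp add: b_def in_keys_iff)
    with \<alpha> show ?thesis by (simp add: \<alpha>_def)
  next
    case False
    with \<open>n \<noteq> 0\<close> have n: "2 \<le> n" by simp
    define x where "x = restrict (\<lambda>i. if i = 1 then 1 else if i = 2 then - 1 else 0 :: real) {1..n}"
    have "(\<Sum>i\<in>{1..n}. x i) = (\<Sum>i\<in>{1, 2}. x i)"
      using n by (intro sum.mono_neutral_right) (auto simp: x_def)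
    also have "\<dots> = 0" using n by (simp add: x_def)
    finally have "(\<Sum>i\<in>{1..n}. x i) = 0" .
    moreover have "0 \<le> evaluate x p"
      unfolding x_def by (rule nonneg_polyD[OF assms(4)])
    ultimately have "0 \<le> \<beta> * (\<Sum>(i, j)\<in>lt_pairs n. (x j - x i)\<^sup>2)"
      unfolding val by simp
    \<comment> \<open>The pair (1, 2) contributes 4, and every other term is a square.\<close>
    moreover have "0 < (\<Sum>(i, j)\<in>lt_pairs n. (x j - x i)\<^sup>2)"
      using n by (intro sum_pos2[of _ "(1, 2)"] finite_lt_pairs) (auto simp: lt_pairs_def x_def)
    ultimately show ?thesis by (simp add: zero_le_mult_iff)
  qed
  have p2: "p = Const (\<alpha> + (real n - 1) * \<beta>) * (\<Sum>i\<in>{1..n}. (X i)\<^sup>2)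
      + Const (2 * (\<alpha> - \<beta>)) * (\<Sum>(i, j)\<in>lt_pairs n. X i * X j)"
    unfolding a b using symmetric_quadratic_form_eq[OF assms(1-3)] by (simp add: a_def b_def)
  \<comment> \<open>Moving \<open>Const\<close> through the arithmetic exposes the shape of
    \<open>quadratic_form_rewrite\<close> in the polynomial ring, with u and v being
    \<open>Const \<alpha>\<close> and \<open>Const \<beta>\<close>.\<close>
  have c1: "Const (\<alpha> + (real n - 1) * \<beta>) = Const \<alpha> + (of_nat n - 1) * Const \<beta>"
    by (simp add: Const_def single_add single_diff mult_single algebra_simps flip: single_of_nat single_one)
  have c2: "Const (2 * (\<alpha> - \<beta>)) = 2 * (Const \<alpha> - Const \<beta>)"
    by (simp only: Const_def single_add single_diff mult_2)
  have p1: "p = Const \<alpha> * (\<Sum>i\<in>{1..n}. X i)\<^sup>2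
      + Const \<beta> * (\<Sum>(i, j)\<in>lt_pairs n. (X j - X i)\<^sup>2)"
    using p2 unfolding quadratic_form_rewrite c1 c2 .
  show ?thesis
    using \<alpha> \<beta> p1 p2 unfolding lt_pairs_def by (intro exI conjI)
qed

end
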